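(* For every $n\ge 2$, the Friedrichs operator of the symmetrized polydisc $\mathbb{G}_n\subset\mathbb{C}^n$ is of rank one.
   Context: $\mathbb{D}$ is the open unit disc in $\mathbb{C}$. The symmetrized polydisc is $\mathbb{G}_n=\pi_n(\mathbb{D}^n)$, the image of the symmetrization map $\pi_n\colon\mathbb{D}^n\to\mathbb{C}^n$, $$\pi_n(z_1,\dots,z_n)=\left(\sum_{1\le i\le n}z_i,\ \sum_{1\le i<j\le n}z_iz_j,\ \dots,\ \prod_{i=1}^n z_i\right),$$ whose components are the elementary symmetric polynomials. For a domain $D\subset\mathbb{C}^n$, the Bergman space $A^2(D)$ is the closed subspace of $L^2(D)$ (with respect to Lebesgue measure, with inner product $\langle f,g\rangle=\int_D f\bar g\,dV$) consisting of holomorphic functions. The Bergman projection $B_D$ is the orthogonal projection of $L^2(D)$ onto $A^2(D)$. The Friedrichs operator of $D$ is the (conjugate-linear) map $F_D\colon A^2(D)\to A^2(D)$, $F_D(g)=B_D(\bar g)$. It is of rank one if its range is a one-dimensional complex vector space. *)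

theory Defs
  imports "HOL-Analysis.Analysis" "HOL-Library.Function_Algebras"
begin

text \<open>
  The space of \<open>n\<close>-tuples of complex numbers is \<^typ>\<open>complex ^ 'n\<close> with \<open>n = CARD('n)\<close>;
  \<^const>\<open>lebesgue\<close> is Lebesgue measure on it, seen as a real space of dimension \<open>2 n\<close>.
  The \<open>linorder\<close> constraint on \<open>'n\<close> serves only to number the coordinates \<open>1, \<dots>, n\<close>.
\<close>

definition position :: "'n::{finite,linorder} \<Rightarrow> nat" where
  "position i = card {j. j \<le> i}"

definition elem_sym :: "nat \<Rightarrow> complex ^ 'n \<Rightarrow> complex" where
  "elem_sym k z = (\<Sum>A | A \<subseteq> (UNIV :: 'n set) \<and> card A = k. \<Prod>i\<in>A. z $ i)"

definition symmetrization :: "complex ^ ('n::{finite,linorder}) \<Rightarrow> complex ^ ('n::{finite,linorder})" where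
  "symmetrization z = (\<chi> i. elem_sym (position i) z)"

definition polydisc :: "(complex ^ 'n) set" where
  "polydisc = {z. \<forall>i. z $ i \<in> ball 0 1}"

definition symmetrized_polydisc :: "(complex ^ 'n::{finite,linorder}) set" where
  "symmetrized_polydisc = symmetrization ` polydisc"

text \<open>Holomorphy in several variables: complex (Frechet) differentiability at every point.\<close>

definition holomorphic_vec_on :: "(complex ^ 'n \<Rightarrow> complex) \<Rightarrow> (complex ^ 'n) set \<Rightarrow> bool" where
  "holomorphic_vec_on f D \<longleftrightarrow>
     (\<forall>z\<in>D. \<exists>f'. (f has_derivative f') (at z within D) \<and> (\<forall>c v. f' (c *s v) = c * f' v))"

definition L2 :: "(complex ^ 'n) set \<Rightarrow> (complex ^ 'n \<Rightarrow> complex) set" where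
  "L2 D = {f. f \<in> borel_measurable (lebesgue_on D) \<and>
              integrable (lebesgue_on D) (\<lambda>z. (cmod (f z))\<^sup>2)}"

definition L2_inner ::
  "(complex ^ 'n) set \<Rightarrow> (complex ^ 'n \<Rightarrow> complex) \<Rightarrow> (complex ^ 'n \<Rightarrow> complex) \<Rightarrow> complex" where
  "L2_inner D f g = (LINT z|lebesgue_on D. f z * cnj (g z))"

text \<open>
  A function on \<open>D\<close> is represented by its extension by \<open>0\<close>, so that equality of elements of
  the Bergman space is equality of functions on \<open>D\<close>. No quotient by null functions is needed
  here: on an open set, holomorphic functions that agree almost everywhere are equal.
\<close>

definition Bergman_space :: "(complex ^ 'n) set \<Rightarrow> (complex ^ 'n \<Rightarrow> complex) set" where
  "Bergman_space D = {f \<in> L2 D. holomorphic_vec_on f D \<and> (\<forall>z. z \<notin> D \<longrightarrow> f z = 0)}"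

text \<open>
  Orthogonal projection, for \<open>f \<in> L2 D\<close>: the unique element of the Bergman space whose
  difference from \<open>f\<close> is orthogonal to that space.
\<close>

definition Bergman_projection ::
  "(complex ^ 'n) set \<Rightarrow> (complex ^ 'n \<Rightarrow> complex) \<Rightarrow> (complex ^ 'n \<Rightarrow> complex)" where
  "Bergman_projection D f =
     (THE h. h \<in> Bergman_space D \<and>
        (\<forall>g\<in>Bergman_space D. L2_inner D (\<lambda>z. f z - h z) g = 0))"

definition Friedrichs ::
  "(complex ^ 'n) set \<Rightarrow> (complex ^ 'n \<Rightarrow> complex) \<Rightarrow> (complex ^ 'n \<Rightarrow> complex)" where
  "Friedrichs D g = Bergman_projection D (\<lambda>z. cnj (g z))"

definition cscale :: "complex \<Rightarrow> ('a \<Rightarrow> complex) \<Rightarrow> ('a \<Rightarrow> complex)" where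
  "cscale c f = (\<lambda>x. c * f x)"

global_interpretation cfun: vector_space "cscale :: complex \<Rightarrow> ('a \<Rightarrow> complex) \<Rightarrow> _"
  by unfold_locales (auto simp: cscale_def fun_eq_iff algebra_simps)

text \<open>The operator \<open>T\<close> with domain \<open>V\<close> has as its range a complex vector space of dimension one.
  (\<open>cfun.dim\<close> is \<open>0\<close> for infinite-dimensional spaces.)\<close>

definition rank_one_on :: "('b \<Rightarrow> ('a \<Rightarrow> complex)) \<Rightarrow> 'b set \<Rightarrow> bool" where
  "rank_one_on T V \<longleftrightarrow> cfun.subspace (T ` V) \<and> cfun.dim (T ` V) = 1"

end

theory Submission
  imports Defs
    "HOL-Complex_Analysis.Cauchy_Integral_Formula"
    "HOL-Computational_Algebra.Fundamental_Theorem_Algebra"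
begin

text \<open>
  The reason is a symmetry of the symmetrized polydisc. Multiplying all roots \<open>z\<^sub>1, \<dots>, z\<^sub>n\<close> by \<open>c\<close>
  multiplies the \<open>k\<close>-th coordinate of their symmetrization by \<open>c ^ k\<close>, so the domain \<open>D\<close> is stable under the
  weighted dilations \<open>(p\<^sub>1, p\<^sub>2, \<dots>, p\<^sub>n) \<mapsto> (c p\<^sub>1, c\<^sup>2 p\<^sub>2, \<dots>, c\<^sup>n p\<^sub>n)\<close> with \<open>\<bar>c\<bar> \<le> 1\<close>. For \<open>\<bar>c\<bar> = 1\<close> these are
  linear isometries and preserve Lebesgue measure. Averaging over the circle \<open>\<bar>c\<bar> = 1\<close> and using Cauchy's
  formula along each orbit yields the mean value property (\<open>quasi_balanced_mean_value\<close>): every integrable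
  holomorphic function \<open>f\<close> on \<open>D\<close> has integral \<open>vol D * f 0\<close>.

  For \<open>g\<close> and \<open>h\<close> in the Bergman space, the inner product of \<open>cnj \<circ> g\<close> with \<open>h\<close> is the conjugate of the
  integral of \<open>g * h\<close>, so it equals \<open>vol D * cnj (g 0 * h 0)\<close>. The constant function \<open>cnj (g 0)\<close> has the
  same inner product with \<open>h\<close>. Hence the Friedrichs operator sends \<open>g\<close> to the constant \<open>cnj (g 0)\<close>
  (\<open>Friedrichs_quasi_balanced\<close>), and its range consists of the constant functions.

  It remains to know that the symmetrized polydisc is bounded and open. Openness
  (\<open>open_symmetrized_polydisc\<close>) amounts to the continuous dependence of the roots of a
  polynomial on its coefficients; it also makes two holomorphic functions equal
  when they agree almost everywhere, so that the projection is unique.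
\<close>

section \<open>Invariance of Lebesgue measure under isometries\<close>

lemma isometry_image_ball:
  fixes T :: "'a::metric_space \<Rightarrow> 'b::metric_space"
  assumes iso: "\<And>x y. dist (T x) (T y) = dist x y" and "surj T"
  shows "T ` ball x r = ball (T x) r"
  using assms by (force simp: surj_def)

text \<open>
  An isometry maps a ball onto a ball of the same radius, hence of the same measure. By Vitali's
  covering theorem an open set is, up to a null set, a countable disjoint union of balls, and this
  property is carried along by the isometry.
\<close>

lemma emeasure_lborel_le_isometry_image:
  fixes T :: "'a::euclidean_space \<Rightarrow> 'a"
  assumes iso: "\<And>x y. dist (T x) (T y) = dist x y" and surj: "surj T"
    and U: "open U" and TU: "open (T ` U)"
  shows "emeasure lborel U \<le> emeasure lborel (T ` U)"
proof -
  define K where "K = {(x, r). 0 < r \<and> ball x r \<subseteq> U}"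
  \<comment> \<open>The balls inside \<open>U\<close> form a Vitali cover of \<open>U\<close>.\<close>
  have "\<exists>i. i \<in> K \<and> x \<in> ball (fst i) (snd i) \<and> snd i < d" if x: "x \<in> U" and d: "0 < d" for x d
  proof -
    obtain e where "0 < e" "ball x e \<subseteq> U"
      using openE[OF U x] .
    then show ?thesis
      using d by (intro exI[of _ "(x, min e (d / 2))"]) (auto simp: K_def)
  qed
  then obtain C where C: "countable C" "C \<subseteq> K"
      "pairwise (\<lambda>i j. disjnt (ball (fst i) (snd i)) (ball (fst j) (snd j))) C"
      "negligible (U - (\<Union>i\<in>C. ball (fst i) (snd i)))"
    using Vitali_covering_theorem_balls[of U K fst snd] by blast
  let ?B = "\<lambda>i. ball (fst i) (snd i)"
  have inj: "inj T"
    by (metis injI iso dist_eq_0_iff)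
  have img: "T ` ?B i = ball (T (fst i)) (snd i)" for i
    by (rule isometry_image_ball[OF iso surj])
  have disj: "disjoint_family_on ?B C"
    using C(3) by (auto simp: disjoint_family_on_def pairwise_def disjnt_def)
  then have disj': "disjoint_family_on (\<lambda>i. T ` ?B i) C"
    using inj by (simp add: disjoint_family_on_def image_Int[symmetric])
  have meas: "T ` ?B i \<in> sets lborel" for i
    by (simp add: img)
  have ball_eq: "emeasure lborel (T ` ?B i) = emeasure lborel (?B i)" if "i \<in> C" for i
    using that C(2) unfolding img by (auto simp: K_def emeasure_ball)
  have balls: "?B i \<subseteq> U" if "i \<in> C" for i
  proof -
    have "i \<in> K"
      using that C(2) by blast
    then show ?thesis
      by (simp add: K_def split_beta)
  qed
  have union: "(\<Union>i\<in>C. ?B i) \<in> sets lborel"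
    using C(1) by auto
  have null: "U - (\<Union>i\<in>C. ?B i) \<in> null_sets lborel"
    using C(4) U union by (auto simp: negligible_iff_null_sets null_sets_def)
  have "emeasure lborel U \<le> emeasure lborel ((\<Union>i\<in>C. ?B i) \<union> (U - (\<Union>i\<in>C. ?B i)))"
    using U union by (intro emeasure_mono) auto
  also have "\<dots> = emeasure lborel (\<Union>i\<in>C. ?B i)"
    by (rule emeasure_Un_null_set[OF union null])
  also have "\<dots> = (\<integral>\<^sup>+i. emeasure lborel (?B i) \<partial>count_space C)"
    using C(1) disj by (intro emeasure_UN_countable) auto
  also have "\<dots> = (\<integral>\<^sup>+i. emeasure lborel (T ` ?B i) \<partial>count_space C)"
    using ball_eq by (intro nn_integral_cong) auto
  also have "\<dots> = emeasure lborel (\<Union>i\<in>C. T ` ?B i)"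
    using C(1) disj' meas by (intro emeasure_UN_countable[symmetric]) auto
  also have "\<dots> \<le> emeasure lborel (T ` U)"
    using balls TU by (intro emeasure_mono) auto
  finally show ?thesis .
qed

text \<open>
  The previous inequality, applied to the isometry and to its inverse, gives equality on open
  sets. These are stable under intersection and generate the Borel sets.
\<close>

lemma distr_lborel_isometry:
  fixes T :: "'a::euclidean_space \<Rightarrow> 'a"
  assumes iso: "\<And>x y. dist (T x) (T y) = dist x y" and surj: "surj T"
  shows "distr lborel borel T = lborel"
proof -
  have inj: "inj T"
    by (metis injI iso dist_eq_0_iff)
  have iso': "dist (inv T x) (inv T y) = dist x y" for x y
    by (metis iso surj surj_f_inv_f)
  have surj': "surj (inv T)"
    using inj by (simp add: inj_imp_surj_inv)
  have cont: "continuous_on UNIV T"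
    unfolding continuous_on_iff using iso by auto
  then have T [measurable]: "T \<in> borel_measurable borel"
    by (rule borel_measurable_continuous_onI)
  have open_eq: "emeasure lborel (T -` U) = emeasure lborel U" if U: "open U" for U
  proof (rule antisym)
    have opre: "open (T -` U)"
      using cont U by (simp add: open_vimage)
    have "T ` (T -` U) = U"
      using surj by (rule surj_image_vimage_eq)
    moreover have "inv T ` U = T -` U"
      using surj inj by (simp add: bij_def bij_vimage_eq_inv_image)
    ultimately show "emeasure lborel (T -` U) \<le> emeasure lborel U"
        "emeasure lborel U \<le> emeasure lborel (T -` U)"
      using emeasure_lborel_le_isometry_image[OF iso surj opre]
        emeasure_lborel_le_isometry_image[OF iso' surj' U] U opre by auto
  qed
  show ?thesis
  proof (rule measure_eqI_generator_eq[where E = "{U. open U}" and \<Omega> = UNIV and A = "\<lambda>n. ball 0 (real n)"])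
    show "Int_stable {U :: 'a set. open U}"
      by (auto simp: Int_stable_def)
    show "emeasure (distr lborel borel T) U = emeasure lborel U" if "U \<in> {U. open U}" for U
      using that open_eq[of U] by (simp add: emeasure_distr)
    show "sets (distr lborel borel T) = sigma_sets UNIV {U. open U}"
         "sets lborel = sigma_sets UNIV {U :: 'a set. open U}"
      by (auto simp: borel_def)
    show "(\<Union>n. ball (0 :: 'a) (real n)) = UNIV"
      using reals_Archimedean2 by auto
    show "emeasure (distr lborel borel T) (ball 0 (real n)) \<noteq> \<infinity>" for n
      using open_eq[of "ball 0 (real n)"] emeasure_lborel_ball_finite[of "0 :: 'a" "real n"]
      by (simp add: emeasure_distr)
  qed auto
qed

section \<open>Weighted dilations\<close>

text \<open>
  The action of the multiplicative monoid of complex numbers with weights \<open>m\<close>. A set stable under it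
  for \<open>\<bar>c\<bar> \<le> 1\<close> is called quasi-balanced; balanced sets are the case where all weights are \<open>1\<close>.
\<close>

definition weighted_dilation :: "('n \<Rightarrow> nat) \<Rightarrow> complex \<Rightarrow> complex ^ 'n \<Rightarrow> complex ^ 'n" where
  "weighted_dilation m c p = (\<chi> i. c ^ m i * p $ i)"

lemma dist_weighted_dilation:
  assumes "cmod c = 1"
  shows "dist (weighted_dilation m c p) (weighted_dilation m c q) = dist p q"
  using assms
  by (simp add: dist_norm weighted_dilation_def norm_vec_def norm_mult norm_power
      flip: right_diff_distrib)

lemma surj_weighted_dilation:
  assumes "c \<noteq> 0"
  shows "surj (weighted_dilation m c)"
proof (rule surjI)
  show "weighted_dilation m c (weighted_dilation m (inverse c) p) = p" for p
    using assms by (simp add: weighted_dilation_def vec_eq_iff power_inverse)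
qed

lemma distr_lborel_weighted_dilation:
  assumes "cmod c = 1"
  shows "distr lborel borel (weighted_dilation m c) = lborel"
  using assms by (intro distr_lborel_isometry dist_weighted_dilation surj_weighted_dilation) auto

lemma integral_weighted_dilation:
  fixes F :: "complex ^ 'n \<Rightarrow> 'b::{banach, second_countable_topology}"
  assumes c: "cmod c = 1" and [measurable]: "F \<in> borel_measurable borel"
  shows "(LINT z|lborel. F (weighted_dilation m c z)) = integral\<^sup>L lborel F"
    and "integrable lborel (\<lambda>z. F (weighted_dilation m c z)) \<longleftrightarrow> integrable lborel F"
proof -
  have "continuous_on UNIV (weighted_dilation m c)"
    unfolding weighted_dilation_def by (intro continuous_intros)
  then have [measurable]: "weighted_dilation m c \<in> borel_measurable borel"
    by (rule borel_measurable_continuous_onI)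
  show "(LINT z|lborel. F (weighted_dilation m c z)) = integral\<^sup>L lborel F"
    by (subst (2) distr_lborel_weighted_dilation[OF c, of m, symmetric]) (simp add: integral_distr)
  show "integrable lborel (\<lambda>z. F (weighted_dilation m c z)) \<longleftrightarrow> integrable lborel F"
    by (subst (2) distr_lborel_weighted_dilation[OF c, of m, symmetric]) (simp add: integrable_distr_eq)
qed

text \<open>
  Restricted to an orbit, a function of several variables becomes a function of one complex
  variable, to which Cauchy's formula applies. The set \<open>S\<close> is arbitrary: only the derivative within
  \<open>D\<close> enters, so that \<open>S\<close> can be the closed disc.
\<close>

lemma holomorphic_on_weighted_orbit:
  assumes f: "holomorphic_vec_on f D"
    and orbit: "\<And>c. c \<in> S \<Longrightarrow> weighted_dilation m c p \<in> D"
  shows "(\<lambda>c. f (weighted_dilation m c p)) holomorphic_on S"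
  unfolding holomorphic_on_def
proof
  fix c assume c: "c \<in> S"
  define w :: "complex ^ 'a" where "w = (\<chi> i. of_nat (m i) * c ^ (m i - 1) * p $ i)"
  have comp: "((\<lambda>c. c ^ m i * p $ i) has_derivative (\<lambda>v. v * w $ i)) (at c within S)" for i
  proof -
    have "((\<lambda>c. c ^ m i * p $ i) has_field_derivative w $ i) (at c within S)"
      unfolding w_def by (auto intro!: derivative_eq_intros)
    moreover have "(*) (w $ i) = (\<lambda>v. v * w $ i)"
      by (simp add: fun_eq_iff)
    ultimately show ?thesis
      by (simp add: has_field_derivative_def)
  qed
  have orb: "((\<lambda>c. weighted_dilation m c p) has_derivative (\<lambda>v. v *s w)) (at c within S)"
    unfolding has_derivative_componentwise_within[of "\<lambda>c. weighted_dilation m c p"]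
  proof
    fix b :: "complex ^ 'a" assume "b \<in> Basis"
    have "((\<lambda>c. \<Sum>i\<in>UNIV. (c ^ m i * p $ i) \<bullet> b $ i) has_derivative
        (\<lambda>v. \<Sum>i\<in>UNIV. (v * w $ i) \<bullet> b $ i)) (at c within S)"
      by (intro has_derivative_sum has_derivative_inner_left comp)
    then show "((\<lambda>c. weighted_dilation m c p \<bullet> b) has_derivative (\<lambda>v. (v *s w) \<bullet> b)) (at c within S)"
      by (simp add: weighted_dilation_def inner_vec_def vector_scalar_mult_def)
  qed
  obtain f' where f': "(f has_derivative f') (at (weighted_dilation m c p) within D)"
      "\<And>c v. f' (c *s v) = c * f' v"
    using f orbit[OF c] unfolding holomorphic_vec_on_def by blast
  have "(f has_derivative f') (at (weighted_dilation m c p) within (\<lambda>c. weighted_dilation m c p) ` S)"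
    using orbit by (intro has_derivative_subset[OF f'(1)]) auto
  from diff_chain_within[OF orb this]
  have "((\<lambda>c. f (weighted_dilation m c p)) has_derivative (\<lambda>v. f' w * v)) (at c within S)"
    by (simp add: f'(2) o_def mult.commute)
  then show "(\<lambda>c. f (weighted_dilation m c p)) field_differentiable at c within S"
    unfolding field_differentiable_def has_field_derivative_def by (rule exI)
qed

section \<open>The mean value property of quasi-balanced domains\<close>

lemma circle_mean_value:
  fixes h :: "complex \<Rightarrow> complex"
  assumes h: "h holomorphic_on cball 0 1"
  shows "(LINT t|lborel. indicator {0..1} t *\<^sub>R h (exp (2 * of_real pi * \<i> * of_real t))) = h 0"
proof -
  let ?c = "\<lambda>t::real. exp (2 * of_real pi * \<i> * of_real t)"
  have cc: "continuous_on {0..1} (\<lambda>t. h (?c t))"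
    by (rule continuous_on_compose2[OF holomorphic_on_imp_continuous_on[OF h]])
      (auto intro!: continuous_intros)
  have "((\<lambda>u. h u / (u - 0)) has_contour_integral (2 * of_real pi * \<i> * h 0)) (circlepath 0 1)"
    by (rule Cauchy_integral_circlepath_simple[OF h]) simp
  then have "((\<lambda>t. 2 * of_real pi * \<i> * h (?c t)) has_integral 2 * of_real pi * \<i> * h 0) {0..1}"
    unfolding has_contour_integral_def
    by (rule has_integral_eq[rotated]) (simp add: vector_derivative_circlepath01, simp add: circlepath)
  then have "((\<lambda>t. (2 * of_real pi * \<i> * h (?c t)) / (2 * of_real pi * \<i>)) has_integral 
      (2 * of_real pi * \<i> * h 0) / (2 * of_real pi * \<i>)) {0..1}"
    by (rule has_integral_divide)
  then have "((\<lambda>t. h (?c t)) has_integral h 0) {0..1}"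
    by simp
  then show ?thesis
    using set_borel_integral_eq_integral(2)[OF borel_integrable_atLeastAtMost'[OF cc]]
    by (simp add: set_lebesgue_integral_def integral_unique)
qed

lemma holomorphic_vec_on_imp_continuous_on:
  assumes "holomorphic_vec_on f D"
  shows "continuous_on D f"
  using assms unfolding holomorphic_vec_on_def continuous_on_eq_continuous_within
  by (blast intro: has_derivative_continuous)

text \<open>
  The integral is unchanged when \<open>f\<close> is rotated by \<open>c\<close> with \<open>\<bar>c\<bar> = 1\<close>, hence also when \<open>f\<close> is replaced
  by its mean over all such rotations. By the one-variable mean value property on each orbit that
  mean is the constant \<open>f 0\<close>, because positive weights contract every orbit to \<open>0\<close>.
\<close>

lemma quasi_balanced_mean_value:
  fixes D :: "(complex ^ 'n) set"
  assumes D: "open D" and m: "\<And>i. 0 < m i"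
    and bal: "\<And>c p. cmod c \<le> 1 \<Longrightarrow> p \<in> D \<Longrightarrow> weighted_dilation m c p \<in> D"
    and f: "holomorphic_vec_on f D" and int: "integrable (lebesgue_on D) f"
  shows "(LINT z|lebesgue_on D. f z) = measure lebesgue D *\<^sub>R f 0"
proof -
  \<comment> \<open>Since \<open>f\<close> is continuous on \<open>D\<close>, its extension by \<open>0\<close> is Borel measurable, so that the product
    measure of two copies of \<open>lborel\<close> suffices for Fubini's theorem.\<close>
  define F where "F z = indicator D z *\<^sub>R f z" for z
  let ?c = "\<lambda>t::real. exp (2 * of_real pi * \<i> * of_real t)"
  have F [measurable]: "F \<in> borel_measurable borel"
    unfolding F_def using D holomorphic_vec_on_imp_continuous_on[OF f]
    by (intro borel_measurable_continuous_on_indicator) auto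
  have Fint: "integrable lborel F" and Feq: "(LINT z|lebesgue_on D. f z) = integral\<^sup>L lborel F"
  proof -
    have "integrable lebesgue F"
      using int D by (simp add: integrable_restrict_space F_def[abs_def])
    then show "integrable lborel F"
      by (simp add: integrable_completion)
    have "(LINT z|lebesgue_on D. f z) = integral\<^sup>L lebesgue F"
      using D by (simp add: integral_restrict_space F_def[abs_def])
    then show "(LINT z|lebesgue_on D. f z) = integral\<^sup>L lborel F"
      by (simp add: integral_completion)
  qed
  define \<Phi> where "\<Phi> t z = indicator {0..1} t *\<^sub>R F (weighted_dilation m (?c t) z)" for t z
  have "continuous_on UNIV (\<lambda>x::real \<times> (complex ^ 'n). weighted_dilation m (?c (fst x)) (snd x))"
    unfolding weighted_dilation_def by (intro continuous_intros)
  then have [measurable]: "(\<lambda>x. weighted_dilation m (?c (fst x)) (snd x)) \<in> 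
      borel_measurable (lborel \<Otimes>\<^sub>M lborel)"
    unfolding lborel_prod by (simp add: borel_measurable_continuous_onI)
  have meas: "case_prod \<Phi> \<in> borel_measurable (lborel \<Otimes>\<^sub>M lborel)"
    unfolding \<Phi>_def case_prod_beta by measurable
  have rot: "integrable lborel (\<Phi> t)" "integral\<^sup>L lborel (\<Phi> t) = indicator {0..1} t *\<^sub>R integral\<^sup>L lborel F"
    "(LINT z|lborel. norm (\<Phi> t z)) = indicator {0..1} t *\<^sub>R (LINT z|lborel. norm (F z))" for t
    using Fint integral_weighted_dilation[of "?c t" F m]
      integral_weighted_dilation(1)[of "?c t" "\<lambda>z. norm (F z)" m]
    by (auto simp: \<Phi>_def[abs_def])
  have "integrable (lborel \<Otimes>\<^sub>M lborel) (case_prod \<Phi>)"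
    using meas
  proof (rule lborel_pair.Fubini_integrable)
    show "integrable lborel (\<lambda>t. LINT z|lborel. norm (case (t, z) of (t, z) \<Rightarrow> \<Phi> t z))"
      by (simp add: rot(3))
  qed (simp add: rot(1))
  from lborel_pair.Fubini_integral[OF this]
  have fubini: "(LINT z|lborel. LINT t|lborel. \<Phi> t z) = integral\<^sup>L lborel F"
    by (simp add: rot(2))
  have orbit_mean: "(LINT t|lborel. \<Phi> t z) = indicator D z *\<^sub>R f 0" for z
  proof (cases "z \<in> D")
    case True
    have zero: "weighted_dilation m 0 z = 0"
      using m by (simp add: weighted_dilation_def vec_eq_iff zero_power)
    have "(LINT t|lborel. \<Phi> t z) = (LINT t|lborel. indicator {0..1} t *\<^sub>R f (weighted_dilation m (?c t) z))"
      unfolding \<Phi>_def F_def using bal[OF _ True] by simp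
    also have "\<dots> = f (weighted_dilation m 0 z)"
      by (rule circle_mean_value, rule holomorphic_on_weighted_orbit[OF f]) (use bal True in auto)
    finally show ?thesis
      using True zero by simp
  next
    case False
    \<comment> \<open>A rotation leading from outside \<open>D\<close> into \<open>D\<close> could be undone by the inverse rotation.\<close>
    have "weighted_dilation m (?c t) z \<notin> D" for t
    proof
      assume *: "weighted_dilation m (?c t) z \<in> D"
      have "weighted_dilation m (inverse (?c t)) (weighted_dilation m (?c t) z) = z"
        by (simp add: weighted_dilation_def vec_eq_iff power_inverse)
      then show False
        using bal[OF _ *, of "inverse (?c t)"] False by (simp add: norm_inverse)
    qed
    then show ?thesis
      using False by (simp add: \<Phi>_def F_def)
  qed
  have "(LINT z|lborel. indicator D z *\<^sub>R f 0) = measure lborel D *\<^sub>R f 0"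
    using D integral_restrict_space[of D lborel "\<lambda>_. f 0"] by (simp add: measure_restrict_space)
  then show ?thesis
    using Feq fubini D by (simp add: orbit_mean measure_completion)
qed

section \<open>The Bergman space and its projection\<close>

text \<open>
  Without conjugation, so that a product of two holomorphic functions is again a holomorphic
  integrable function; inner products are covered through \<open>cnj_mem_L2\<close>.
\<close>

lemma L2_integrable_mult:
  assumes "f \<in> L2 D" "g \<in> L2 D"
  shows "integrable (lebesgue_on D) (\<lambda>z. f z * g z)"
proof (rule Bochner_Integration.integrable_bound)
  show "integrable (lebesgue_on D) (\<lambda>z. (cmod (f z))\<^sup>2 + (cmod (g z))\<^sup>2)"
    using assms by (simp add: L2_def)
  show "(\<lambda>z. f z * g z) \<in> borel_measurable (lebesgue_on D)"
    using assms by (auto simp: L2_def intro: borel_measurable_times)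
  have "cmod (f z * g z) \<le> (cmod (f z))\<^sup>2 + (cmod (g z))\<^sup>2" for z
    using sum_squares_bound[of "cmod (f z)" "cmod (g z)"] 
      mult_nonneg_nonneg[OF norm_ge_zero norm_ge_zero, of "f z" "g z"]
    unfolding norm_mult by linarith
  then show "AE z in lebesgue_on D. norm (f z * g z) \<le> norm ((cmod (f z))\<^sup>2 + (cmod (g z))\<^sup>2)"
    by auto
qed

lemma cnj_mem_L2:
  assumes "f \<in> L2 D"
  shows "(\<lambda>z. cnj (f z)) \<in> L2 D"
proof -
  have "(\<lambda>z. cnj (f z)) \<in> borel_measurable (lebesgue_on D)"
    using assms by (intro borel_measurable_continuous_on[where f = cnj]) (auto simp: L2_def intro: continuous_intros)
  then show ?thesis
    using assms by (simp add: L2_def)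
qed

lemma diff_mem_L2:
  assumes f: "f \<in> L2 D" and g: "g \<in> L2 D"
  shows "(\<lambda>z. f z - g z) \<in> L2 D"
proof -
  have meas: "f \<in> borel_measurable (lebesgue_on D)" "g \<in> borel_measurable (lebesgue_on D)"
    using f g by (auto simp: L2_def)
  have "integrable (lebesgue_on D) (\<lambda>z. (cmod (f z - g z))\<^sup>2)"
  proof (rule Bochner_Integration.integrable_bound)
    show "integrable (lebesgue_on D) (\<lambda>z. 2 * (cmod (f z))\<^sup>2 + 2 * (cmod (g z))\<^sup>2)"
      using f g by (simp add: L2_def)
    show "(\<lambda>z. (cmod (f z - g z))\<^sup>2) \<in> borel_measurable (lebesgue_on D)"
      using meas by measurable
    have "(cmod (f z - g z))\<^sup>2 \<le> 2 * (cmod (f z))\<^sup>2 + 2 * (cmod (g z))\<^sup>2" for z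
    proof -
      have "(cmod (f z - g z))\<^sup>2 \<le> (cmod (f z) + cmod (g z))\<^sup>2"
        by (intro power_mono norm_triangle_ineq4) auto
      also have "\<dots> \<le> 2 * (cmod (f z))\<^sup>2 + 2 * (cmod (g z))\<^sup>2"
        using sum_squares_bound[of "cmod (f z)" "cmod (g z)"] by (simp add: power2_sum)
      finally show ?thesis .
    qed
    then show "AE z in lebesgue_on D. norm ((cmod (f z - g z))\<^sup>2)
        \<le> norm (2 * (cmod (f z))\<^sup>2 + 2 * (cmod (g z))\<^sup>2)"
      by auto
  qed
  then show ?thesis
    using meas by (simp add: L2_def)
qed

lemma holomorphic_vec_on_diff:
  assumes "holomorphic_vec_on f D" "holomorphic_vec_on g D"
  shows "holomorphic_vec_on (\<lambda>z. f z - g z) D"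
  unfolding holomorphic_vec_on_def
proof
  fix z assume "z \<in> D"
  then obtain f' g' where "(f has_derivative f') (at z within D)" "\<And>c v. f' (c *s v) = c * f' v"
      "(g has_derivative g') (at z within D)" "\<And>c v. g' (c *s v) = c * g' v"
    using assms unfolding holomorphic_vec_on_def by meson
  then show "\<exists>h'. ((\<lambda>z. f z - g z) has_derivative h') (at z within D) \<and> (\<forall>c v. h' (c *s v) = c * h' v)"
    by (intro exI[of _ "\<lambda>v. f' v - g' v"]) (auto intro: has_derivative_diff simp: algebra_simps)
qed

lemma holomorphic_vec_on_mult:
  assumes "holomorphic_vec_on f D" "holomorphic_vec_on g D"
  shows "holomorphic_vec_on (\<lambda>z. f z * g z) D"
  unfolding holomorphic_vec_on_def
proof
  fix z assume "z \<in> D"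
  then obtain f' g' where "(f has_derivative f') (at z within D)" "\<And>c v. f' (c *s v) = c * f' v"
      "(g has_derivative g') (at z within D)" "\<And>c v. g' (c *s v) = c * g' v"
    using assms unfolding holomorphic_vec_on_def by meson
  then show "\<exists>h'. ((\<lambda>z. f z * g z) has_derivative h') (at z within D) \<and> (\<forall>c v. h' (c *s v) = c * h' v)"
    by (intro exI[of _ "\<lambda>v. f z * g' v + f' v * g z"])
      (auto intro: has_derivative_mult simp: algebra_simps)
qed

lemma diff_mem_Bergman_space:
  assumes "f \<in> Bergman_space D" "g \<in> Bergman_space D"
  shows "(\<lambda>z. f z - g z) \<in> Bergman_space D"
  using assms by (simp add: Bergman_space_def diff_mem_L2 holomorphic_vec_on_diff)

lemma indicator_mem_Bergman_space:
  assumes "open D" "bounded D"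
  shows "cscale c (indicator D) \<in> Bergman_space D"
proof -
  have D: "D \<in> sets lebesgue"
    using assms(1) by simp
  have "integrable (lebesgue_on D) (\<lambda>z. (cmod c)\<^sup>2)"
    using finite_measure_lebesgue_on[OF lmeasurable_open[OF assms(2,1)]]
    by (rule finite_measure.integrable_const)
  moreover have "integrable (lebesgue_on D) (\<lambda>z. (cmod (c * indicator D z))\<^sup>2) \<longleftrightarrow>
      integrable (lebesgue_on D) (\<lambda>z. (cmod c)\<^sup>2)"
    by (rule Bochner_Integration.integrable_cong) auto
  moreover have "(\<lambda>z. c * indicator D z) \<in> borel_measurable (lebesgue_on D)"
    using D by (intro borel_measurable_times borel_measurable_const borel_measurable_indicator)
      (auto simp: sets_restrict_space image_iff intro!: bexI[of _ D])
  moreover have "holomorphic_vec_on (\<lambda>z. c * indicator D z) D"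
    unfolding holomorphic_vec_on_def
  proof
    fix z assume z: "z \<in> D"
    have "((\<lambda>z. c * indicator D z) has_derivative (\<lambda>_. 0)) (at z within D)"
      by (rule has_derivative_transform[OF z _ has_derivative_const[of c]]) simp
    then show "\<exists>f'. ((\<lambda>z. c * indicator D z) has_derivative f') (at z within D)
        \<and> (\<forall>c v. f' (c *s v) = c * f' v)"
      by force
  qed
  ultimately show ?thesis
    by (auto simp: Bergman_space_def L2_def cscale_def)
qed

text \<open>
  A function of norm zero vanishes almost everywhere. By continuity the set where it does not vanish
  is open, and an open null set is empty.
\<close>

lemma Bergman_space_inner_self_eq_0:
  assumes D: "open D" and h: "h \<in> Bergman_space D" and inner: "L2_inner D h h = 0"
  shows "h = (\<lambda>_. 0)"
proof -
  have hL2: "h \<in> L2 D" and holo: "holomorphic_vec_on h D"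
    using h by (auto simp: Bergman_space_def)
  have "L2_inner D h h = of_real (LINT z|lebesgue_on D. (cmod (h z))\<^sup>2)"
    by (simp add: L2_inner_def complex_norm_square[symmetric] del: of_real_power)
  then have "(LINT z|lebesgue_on D. (cmod (h z))\<^sup>2) = 0"
    using inner by simp
  then have "AE z in lebesgue_on D. (cmod (h z))\<^sup>2 = 0"
    using hL2 by (subst (asm) integral_nonneg_eq_0_iff_AE) (auto simp: L2_def)
  then have "AE z in lebesgue. z \<in> D \<longrightarrow> h z = 0"
    using D by (simp add: AE_restrict_space_iff)
  then have ae: "AE z in lebesgue. z \<notin> {z \<in> D. h z \<in> - {0}}"
    by eventually_elim auto
  have op: "open {z \<in> D. h z \<in> - {0}}"
    using continuous_open_preimage[OF holomorphic_vec_on_imp_continuous_on[OF holo] D, of "- {0}"]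
      open_Compl[OF closed_singleton[of "0 :: complex"]]
    by (simp add: vimage_def Int_def)
  then have "{z \<in> D. h z \<in> - {0}} \<in> sets lebesgue"
    by simp
  then have "negligible {z \<in> D. h z \<in> - {0}}"
    using ae by (simp only: negligible_iff_null_sets AE_iff_null_sets)
  then have "{z \<in> D. h z \<in> - {0}} = {}"
    using op open_not_negligible by blast
  then show ?thesis
    using h by (auto simp: Bergman_space_def)
qed

text \<open>
  Uniqueness of the orthogonal projection: the difference of two candidates lies in the Bergman space
  and is orthogonal to that space, in particular to itself.
\<close>

lemma Bergman_projection_eqI:
  assumes D: "open D" and f: "f \<in> L2 D" and h: "h \<in> Bergman_space D"
    and orth: "\<And>g. g \<in> Bergman_space D \<Longrightarrow> L2_inner D (\<lambda>z. f z - h z) g = 0"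
  shows "Bergman_projection D f = h"
  unfolding Bergman_projection_def
proof (rule the_equality)
  show "h \<in> Bergman_space D \<and> (\<forall>g\<in>Bergman_space D. L2_inner D (\<lambda>z. f z - h z) g = 0)"
    using h orth by blast
next
  fix k assume k: "k \<in> Bergman_space D \<and> (\<forall>g\<in>Bergman_space D. L2_inner D (\<lambda>z. f z - k z) g = 0)"
  let ?d = "\<lambda>z. h z - k z"
  have d: "?d \<in> Bergman_space D"
    using h k diff_mem_Bergman_space by blast
  have L2: "h \<in> L2 D" "k \<in> L2 D" "?d \<in> L2 D"
    using h k d by (auto simp: Bergman_space_def)
  have "L2_inner D ?d ?d = (LINT z|lebesgue_on D. (f z - k z) * cnj (?d z) - (f z - h z) * cnj (?d z))"
    unfolding L2_inner_def by (rule Bochner_Integration.integral_cong) (auto simp: algebra_simps)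
  also have "\<dots> = L2_inner D (\<lambda>z. f z - k z) ?d - L2_inner D (\<lambda>z. f z - h z) ?d"
    unfolding L2_inner_def using f L2
    by (intro Bochner_Integration.integral_diff L2_integrable_mult diff_mem_L2 cnj_mem_L2)
  also have "\<dots> = 0"
    using orth[OF d] k d by simp
  finally have "?d = (\<lambda>_. 0)"
    by (rule Bergman_space_inner_self_eq_0[OF D d])
  then show "k = h"
    by (simp add: fun_eq_iff)
qed

section \<open>The Friedrichs operator of a quasi-balanced domain\<close>

text \<open>
  For holomorphic \<open>g\<close> and \<open>h\<close> the inner product of \<open>cnj \<circ> g\<close> with \<open>h\<close> is the conjugate of the integral
  of the holomorphic function \<open>g * h\<close>. Replacing \<open>g\<close> by \<open>g - g 0\<close> makes that product vanish at \<open>0\<close>,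
  and the mean value property then says that \<open>cnj \<circ> g\<close> minus the constant \<open>cnj (g 0)\<close> is orthogonal
  to the Bergman space.
\<close>

lemma Friedrichs_quasi_balanced:
  fixes D :: "(complex ^ 'n) set"
  assumes D: "open D" "bounded D" and m: "\<And>i. 0 < m i"
    and bal: "\<And>c p. cmod c \<le> 1 \<Longrightarrow> p \<in> D \<Longrightarrow> weighted_dilation m c p \<in> D"
    and g: "g \<in> Bergman_space D"
  shows "Friedrichs D g = cscale (cnj (g 0)) (indicator D)"
  unfolding Friedrichs_def
proof (rule Bergman_projection_eqI[OF D(1)])
  show "(\<lambda>z. cnj (g z)) \<in> L2 D"
    using g by (simp add: Bergman_space_def cnj_mem_L2)
  show "cscale (cnj (g 0)) (indicator D) \<in> Bergman_space D"
    by (rule indicator_mem_Bergman_space[OF D])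
next
  fix h assume h: "h \<in> Bergman_space D"
  define g0 where "g0 z = g z - cscale (g 0) (indicator D) z" for z
  have g0: "g0 \<in> Bergman_space D"
    unfolding g0_def[abs_def] by (rule diff_mem_Bergman_space[OF g indicator_mem_Bergman_space[OF D]])
  have g00: "g0 0 = 0"
    using g by (auto simp: g0_def cscale_def Bergman_space_def indicator_def)
  have "L2_inner D (\<lambda>z. cnj (g z) - cscale (cnj (g 0)) (indicator D) z) h =
      (LINT z|lebesgue_on D. cnj (g0 z * h z))"
    unfolding L2_inner_def
    by (rule Bochner_Integration.integral_cong) (auto simp: g0_def cscale_def indicator_def)
  also have "\<dots> = cnj (LINT z|lebesgue_on D. g0 z * h z)"
    by (rule Bochner_Integration.integral_cnj)
  also have "(LINT z|lebesgue_on D. g0 z * h z) = measure lebesgue D *\<^sub>R (g0 0 * h 0)"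
    using g0 h by (intro quasi_balanced_mean_value[OF D(1) m bal] holomorphic_vec_on_mult
        L2_integrable_mult) (auto simp: Bergman_space_def)
  finally show "L2_inner D (\<lambda>z. cnj (g z) - cscale (cnj (g 0)) (indicator D) z) h = 0"
    by (simp add: g00)
qed

lemma rank_one_on_Friedrichs_quasi_balanced:
  fixes D :: "(complex ^ 'n) set"
  assumes D: "open D" "bounded D" "D \<noteq> {}" and m: "\<And>i. 0 < m i"
    and bal: "\<And>c p. cmod c \<le> 1 \<Longrightarrow> p \<in> D \<Longrightarrow> weighted_dilation m c p \<in> D"
  shows "rank_one_on (Friedrichs D) (Bergman_space D)"
proof -
  let ?one = "indicator D :: complex ^ 'n \<Rightarrow> complex"
  obtain p where "p \<in> D"
    using D(3) by blast
  moreover have "weighted_dilation m 0 p = 0"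
    using m by (simp add: weighted_dilation_def vec_eq_iff zero_power)
  ultimately have D0: "0 \<in> D"
    using bal[of 0 p] by simp
  have "Friedrichs D ` Bergman_space D = range (\<lambda>c. cscale c ?one)"
  proof
    show "Friedrichs D ` Bergman_space D \<subseteq> range (\<lambda>c. cscale c ?one)"
      using Friedrichs_quasi_balanced[OF D(1,2) m bal] by auto
    show "range (\<lambda>c. cscale c ?one) \<subseteq> Friedrichs D ` Bergman_space D"
    proof safe
      fix c
      have "Friedrichs D (cscale (cnj c) ?one) = cscale (cnj (cscale (cnj c) ?one 0)) ?one"
        by (rule Friedrichs_quasi_balanced[OF D(1,2) m bal indicator_mem_Bergman_space[OF D(1,2)]])
      also have "cnj (cscale (cnj c) ?one 0) = c"
        using D0 by (simp add: cscale_def)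
      finally show "cscale c ?one \<in> Friedrichs D ` Bergman_space D"
        using indicator_mem_Bergman_space[OF D(1,2)] by (metis imageI)
    qed
  qed
  then have range: "Friedrichs D ` Bergman_space D = cfun.span {?one}"
    by (simp add: cfun.span_singleton)
  have "?one \<noteq> 0"
    using D0 by (auto simp: fun_eq_iff indicator_def)
  then have "cfun.dim (cfun.span {?one}) = 1"
    by (subst cfun.dim_span_eq_card_independent) auto
  then show ?thesis
    unfolding rank_one_on_def range by (simp add: cfun.subspace_span)
qed

section \<open>The symmetrized polydisc is quasi-balanced and bounded\<close>

lemma bij_betw_position:
  "bij_betw (position :: 'n::{finite,linorder} \<Rightarrow> nat) UNIV {1..CARD('n)}"
proof -
  have mono: "position i < position j" if "i < j" for i j :: 'n
    unfolding position_def
  proof (rule psubset_card_mono)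
    show "{k. k \<le> i} \<subset> {k. k \<le> j}"
      using that by (auto simp: psubset_eq set_eq_iff intro!: exI[of _ j])
  qed simp
  have inj: "inj (position :: 'n \<Rightarrow> nat)"
    by (rule linorder_injI) (use mono in \<open>metis less_irrefl\<close>)
  have "position i \<in> {1..CARD('n)}" for i :: 'n
  proof -
    have "0 < card {j. j \<le> i}"
      by (subst card_gt_0_iff) auto
    moreover have "card {j. j \<le> i} \<le> CARD('n)"
      by (intro card_mono) auto
    ultimately show ?thesis
      by (simp add: position_def)
  qed
  then show ?thesis
    using inj by (intro bij_betw_imageI card_subset_eq) (auto simp: card_image)
qed

lemma position_pos: "0 < position i" and position_le: "position (i :: 'n::{finite,linorder}) \<le> CARD('n)"
  using bij_betw_position[where 'n = 'n] by (force simp: bij_betw_def)+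

text \<open>
  The \<open>k\<close>-th elementary symmetric polynomial is homogeneous of degree \<open>k\<close>, so scaling the roots
  scales their symmetrization with the weights \<open>1, \<dots>, n\<close>.
\<close>

lemma weighted_dilation_symmetrization:
  "weighted_dilation position c (symmetrization z) = symmetrization (c *s z)"
  by (simp add: weighted_dilation_def symmetrization_def elem_sym_def vec_eq_iff
      prod.distrib sum_distrib_left)

lemma weighted_dilation_symmetrized_polydisc:
  assumes c: "cmod c \<le> 1" and p: "p \<in> symmetrized_polydisc"
  shows "weighted_dilation position c p \<in> symmetrized_polydisc"
proof -
  obtain z where z: "p = symmetrization z" "z \<in> polydisc"
    using p by (auto simp: symmetrized_polydisc_def)
  have "cmod (c * z $ i) < 1" for i
  proof -
    have "cmod (z $ i) < 1"
      using z(2) by (auto simp: polydisc_def)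
    then show ?thesis
      using c mult_left_le_one_le[of "cmod (z $ i)" "cmod c"] by (simp add: norm_mult)
  qed
  then have "c *s z \<in> polydisc"
    by (simp add: polydisc_def)
  then show ?thesis
    using z(1) by (auto simp: weighted_dilation_symmetrization symmetrized_polydisc_def)
qed

lemma bounded_polydisc: "bounded (polydisc :: (complex ^ 'n) set)"
proof (rule boundedI)
  fix z :: "complex ^ 'n" assume "z \<in> polydisc"
  then have "(\<Sum>i\<in>UNIV. norm (z $ i)) \<le> (\<Sum>i\<in>(UNIV :: 'n set). 1)"
    by (intro sum_mono) (auto simp: polydisc_def less_imp_le)
  then show "norm z \<le> real CARD('n)"
    using L2_set_le_sum[of UNIV "\<lambda>i. norm (z $ i)"] by (simp add: norm_vec_def)
qed

lemma bounded_symmetrized_polydisc: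
  "bounded (symmetrized_polydisc :: (complex ^ 'n::{finite,linorder}) set)"
proof -
  have "continuous_on S symmetrization" for S :: "(complex ^ 'n::{finite,linorder}) set"
    unfolding symmetrization_def[abs_def] elem_sym_def by (intro continuous_intros)
  then have "compact (symmetrization ` closure (polydisc :: (complex ^ 'n::{finite,linorder}) set))"
    by (intro compact_continuous_image) (auto simp: compact_closure bounded_polydisc)
  then show ?thesis
    unfolding symmetrized_polydisc_def
    by (rule bounded_subset[OF compact_imp_bounded]) (use closure_subset in blast)
qed

section \<open>The symmetrized polydisc is open\<close>

text \<open>
  The monic polynomial with coefficient vector \<open>w\<close>, signed so that a point \<open>z\<close> with symmetrization \<open>w\<close>
  lists its roots with multiplicity.
\<close>

definition root_poly :: "complex ^ 'n::{finite,linorder} \<Rightarrow> complex poly" where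
  "root_poly w = monom 1 CARD('n) + (\<Sum>i\<in>UNIV. monom ((-1) ^ position i * w $ i) (CARD('n) - position i))"

lemma poly_root_poly:
  fixes w :: "complex ^ 'n::{finite,linorder}"
  shows "poly (root_poly w) x = x ^ CARD('n) + (\<Sum>i\<in>UNIV. (-1) ^ position i * w $ i * x ^ (CARD('n) - position i))"
  by (simp add: root_poly_def poly_sum poly_monom)

lemma coeff_root_poly:
  fixes w :: "complex ^ 'n::{finite,linorder}"
  shows "coeff (root_poly w) (CARD('n) - position i) = (-1) ^ position i * w $ i"
proof -
  have "CARD('n) - position j = CARD('n) - position i \<longleftrightarrow> j = i" for j
    using position_le[of i] position_le[of j] bij_betw_position[where 'n = 'n]
    by (auto simp: bij_betw_def inj_def)
  moreover have "CARD('n) \<noteq> CARD('n) - position i"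
    using position_pos[of i] position_le[of i] by linarith
  ultimately show ?thesis
    by (simp add: root_poly_def coeff_sum if_distrib cong: if_cong)
qed

lemma root_poly_monic:
  fixes w :: "complex ^ 'n::{finite,linorder}"
  shows "degree (root_poly w) = CARD('n)" "lead_coeff (root_poly w) = 1"
proof -
  have low: "degree (\<Sum>i\<in>UNIV. monom ((-1) ^ position i * w $ i) (CARD('n) - position i)) < CARD('n)"
  proof (rule degree_sum_less)
    show "degree (monom ((-1) ^ position i * w $ i) (CARD('n) - position i)) < CARD('n)" for i
      using position_pos[of i] position_le[of i]
      by (intro le_less_trans[OF degree_monom_le]) simp
  qed simp
  then show deg: "degree (root_poly w) = CARD('n)"
    unfolding root_poly_def by (subst degree_add_eq_left) (auto simp: degree_monom_eq)
  show "lead_coeff (root_poly w) = 1"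
    unfolding deg unfolding root_poly_def using low by (simp add: coeff_eq_0)
qed

text \<open>
  Vieta's formula: the terms in the expansion of the product are grouped by the number of factors
  contributing a root.
\<close>

lemma poly_root_poly_symmetrization:
  fixes z :: "complex ^ 'n::{finite,linorder}"
  shows "poly (root_poly (symmetrization z)) x = (\<Prod>i\<in>UNIV. x - z $ i)"
proof -
  let ?N = "CARD('n)"
  have card_le: "card A \<le> ?N" for A :: "'n set"
    by (rule card_mono) auto
  have "(\<Prod>i\<in>UNIV. x - z $ i) = (\<Prod>i\<in>UNIV. - z $ i + x)"
    by simp
  also have "\<dots> = (\<Sum>A\<in>Pow UNIV. (\<Prod>i\<in>A. - z $ i) * (\<Prod>i\<in>UNIV - A. x))"
    by (rule prod_add) simp
  also have "\<dots> = (\<Sum>A\<in>UNIV. (-1) ^ card A * (\<Prod>i\<in>A. z $ i) * x ^ (?N - card A))"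
    by (simp add: prod_uminus card_Diff_subset)
  also have "\<dots> = (\<Sum>k\<in>{0..?N}. \<Sum>A | A \<in> UNIV \<and> card A = k. (-1) ^ card A * (\<Prod>i\<in>A. z $ i) * x ^ (?N - card A))"
    using card_le by (intro sum.group[symmetric]) auto
  also have "\<dots> = (\<Sum>k\<in>{0..?N}. (-1) ^ k * elem_sym k z * x ^ (?N - k))"
    by (intro sum.cong) (auto simp: elem_sym_def sum_distrib_left sum_distrib_right intro!: sum.cong)
  also have "{0..?N} = insert 0 {1..?N}"
    by auto
  also have "(\<Sum>k\<in>insert 0 {1..?N}. (-1) ^ k * elem_sym k z * x ^ (?N - k)) =
      elem_sym 0 z * x ^ ?N + (\<Sum>k\<in>{1..?N}. (-1) ^ k * elem_sym k z * x ^ (?N - k))"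
    by (subst sum.insert) auto
  also have "elem_sym 0 z = 1"
  proof -
    have "{A :: 'n set. A \<subseteq> UNIV \<and> card A = 0} = {{}}"
      by auto
    then show ?thesis
      by (simp add: elem_sym_def)
  qed
  also have "(\<Sum>k\<in>{1..?N}. (-1) ^ k * elem_sym k z * x ^ (?N - k)) =
      (\<Sum>i\<in>UNIV. (-1) ^ position i * elem_sym (position (i :: 'n)) z * x ^ (?N - position i))"
    by (rule sum.reindex_bij_betw[OF bij_betw_position, symmetric])
  finally show ?thesis
    by (simp add: poly_root_poly symmetrization_def)
qed

lemma inj_root_poly: "inj root_poly"
proof (rule injI)
  fix v w :: "complex ^ 'n::{finite,linorder}"
  assume "root_poly v = root_poly w"
  then have "(-1) ^ position i * v $ i = (-1) ^ position i * w $ i" for i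
    using coeff_root_poly[of v i] coeff_root_poly[of w i] by simp
  then show "v = w"
    by (simp add: vec_eq_iff)
qed

text \<open>
  By the fundamental theorem of algebra the polynomial with coefficient vector \<open>w\<close> has \<open>n\<close> roots; listed
  in any order they form a preimage of \<open>w\<close>.
\<close>

lemma surj_symmetrization:
  "surj (symmetrization :: complex ^ 'n::{finite,linorder} \<Rightarrow> complex ^ 'n::{finite,linorder})"
proof -
  have "\<exists>z. w = symmetrization z" for w :: "complex ^ 'n::{finite,linorder}"
  proof -
    have "root_poly w \<noteq> 0"
      using root_poly_monic(2)[of w] by auto
    then obtain A where size: "size A = degree (root_poly w)"
        and factors: "root_poly w = smult (lead_coeff (root_poly w)) (\<Prod>x\<in>#A. [:-x, 1:])"
      using alg_closed_imp_factorization by blast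
    note A = size[unfolded root_poly_monic(1)] factors[unfolded root_poly_monic(2) smult_1_left]
    obtain xs where xs: "mset xs = A"
      using ex_mset by blast
    have len: "length xs = CARD('n)"
      using A(1) xs by auto
    \<comment> \<open>Positions start at \<open>1\<close>, list indices at \<open>0\<close>.\<close>
    define z :: "complex ^ 'n::{finite,linorder}" where "z = (\<chi> i. xs ! (position i - 1))"
    have "poly (root_poly w) x = poly (root_poly (symmetrization z)) x" for x
    proof -
      have "poly (root_poly w) x = (\<Prod>y\<leftarrow>xs. x - y)"
        unfolding A(2) xs[symmetric] by (induction xs) (auto simp: algebra_simps)
      also have "\<dots> = (\<Prod>k\<in>{0..<CARD('n)}. x - xs ! k)"
        by (simp add: prod.list_conv_set_nth len)
      also have "\<dots> = (\<Prod>k\<in>{1..CARD('n)}. x - xs ! (k - 1))"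
        by (rule prod.reindex_bij_witness[of _ "\<lambda>k. k - 1" Suc]) auto
      also have "\<dots> = (\<Prod>i\<in>UNIV. x - xs ! (position (i :: 'n) - 1))"
        by (rule prod.reindex_bij_betw[OF bij_betw_position, symmetric])
      finally show ?thesis
        by (simp add: poly_root_poly_symmetrization z_def)
    qed
    then have "root_poly w = root_poly (symmetrization z)"
      by (simp add: poly_eq_poly_eq_iff[symmetric] fun_eq_iff)
    then show ?thesis
      using inj_root_poly by (auto dest: injD)
  qed
  then show ?thesis
    by (auto simp: surj_def)
qed

text \<open>
  A point lies in the symmetrized polydisc iff all roots of its polynomial lie in the unit disc, and this
  condition is stable under small changes of the coefficients. Quantitatively, if all roots \<open>z $ i\<close> of
  the polynomial of \<open>w\<close> lie in the disc and \<open>\<bar>x\<bar> \<ge> 1\<close>, then its value at \<open>x\<close> is at least \<open>\<bar>x\<bar> ^ n * d\<close> in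
  modulus, where \<open>d\<close> is the product of the numbers \<open>1 - \<bar>z $ i\<bar>\<close>. A change of the coefficients by less
  than \<open>d\<close> in the \<open>\<ell>\<^sup>1\<close> norm alters this value by less than \<open>\<bar>x\<bar> ^ n * d\<close> and so creates no zero at \<open>x\<close>.
\<close>

lemma open_symmetrized_polydisc:
  "open (symmetrized_polydisc :: (complex ^ 'n::{finite,linorder}) set)"
proof (subst open_subopen, safe)
  fix w :: "complex ^ 'n::{finite,linorder}" assume "w \<in> symmetrized_polydisc"
  then obtain z where z: "w = symmetrization z" and "z \<in> polydisc"
    by (auto simp: symmetrized_polydisc_def)
  then have z1: "cmod (z $ i) < 1" for i
    by (simp add: polydisc_def)
  let ?N = "CARD('n)"
  define d where "d = (\<Prod>i\<in>UNIV. 1 - cmod (z $ i))"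
  define U where "U = {w' :: complex ^ 'n::{finite,linorder}. (\<Sum>i\<in>UNIV. cmod (w' $ i - w $ i)) < d}"
  have "0 < d"
    unfolding d_def using z1 by (intro prod_pos) auto
  then have "w \<in> U"
    by (simp add: U_def)
  moreover have "open U"
    unfolding U_def by (intro open_Collect_less continuous_intros)
  moreover have "w' \<in> symmetrized_polydisc" if w': "w' \<in> U" for w'
  proof -
    obtain z' where z': "w' = symmetrization z'"
      using surj_symmetrization by (auto simp: surj_def)
    have "cmod (z' $ j) < 1" for j
    proof (rule ccontr)
      define x where "x = z' $ j"
      assume "\<not> cmod (z' $ j) < 1"
      then have x1: "1 \<le> cmod x"
        by (simp add: x_def)
      have root: "poly (root_poly w') x = 0"
        unfolding z' poly_root_poly_symmetrization by (auto simp: x_def)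
      have "cmod x ^ ?N * d = (\<Prod>i\<in>UNIV. cmod x * (1 - cmod (z $ i)))"
        by (simp add: d_def prod.distrib)
      also have "\<dots> \<le> (\<Prod>i\<in>UNIV. cmod (x - z $ i))"
      proof (intro prod_mono conjI)
        fix i
        show "0 \<le> cmod x * (1 - cmod (z $ i))"
          using z1[of i] by simp
        have "1 * cmod (z $ i) \<le> cmod x * cmod (z $ i)"
          using x1 by (intro mult_right_mono) auto
        then show "cmod x * (1 - cmod (z $ i)) \<le> cmod (x - z $ i)"
          using norm_triangle_ineq2[of x "z $ i"] by (simp add: algebra_simps)
      qed
      also have "\<dots> = cmod (poly (root_poly w') x - poly (root_poly w) x)"
        unfolding root unfolding z poly_root_poly_symmetrization by (simp add: prod_norm)
      also have "poly (root_poly w') x - poly (root_poly w) x =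
          (\<Sum>i\<in>UNIV. (-1) ^ position i * (w' $ i - w $ i) * x ^ (?N - position i))"
        by (simp add: poly_root_poly sum_subtractf[symmetric] algebra_simps)
      also have "cmod \<dots> \<le> (\<Sum>i\<in>UNIV. cmod (w' $ i - w $ i) * cmod x ^ (?N - position i))"
        by (rule order_trans[OF norm_sum]) (simp add: norm_mult norm_power)
      also have "\<dots> \<le> (\<Sum>i\<in>UNIV. cmod (w' $ i - w $ i) * cmod x ^ ?N)"
        using x1 by (intro sum_mono mult_left_mono power_increasing) auto
      also have "\<dots> < d * cmod x ^ ?N"
        using w' x1 unfolding sum_distrib_right[symmetric] U_def
        by (intro mult_strict_right_mono zero_less_power less_le_trans[OF zero_less_one]) auto
      finally show False
        by (simp add: mult.commute)
    qed
    then show ?thesis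
      by (auto simp: z' symmetrized_polydisc_def polydisc_def)
  qed
  ultimately show "\<exists>T. open T \<and> w \<in> T \<and> T \<subseteq> symmetrized_polydisc"
    by blast
qed

lemma symmetrized_polydisc_nonempty: "symmetrized_polydisc \<noteq> {}"
proof -
  have "0 \<in> polydisc"
    by (simp add: polydisc_def)
  then show ?thesis
    unfolding symmetrized_polydisc_def by blast
qed

section \<open>The rank of the Friedrichs operator\<close>

theorem theorem4p6:
  assumes "CARD('n::{finite,linorder}) \<ge> 2"
  shows "rank_one_on (Friedrichs (symmetrized_polydisc :: (complex ^ 'n::{finite,linorder}) set))
           (Bergman_space (symmetrized_polydisc :: (complex ^ 'n::{finite,linorder}) set))"
  by (rule rank_one_on_Friedrichs_quasi_balanced[OF open_symmetrized_polydisc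
        bounded_symmetrized_polydisc symmetrized_polydisc_nonempty position_pos
        weighted_dilation_symmetrized_polydisc])

end
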